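(* Let $C\subseteq\mathbb R^d$ be a closed salient convex cone with order unit $u$ (i.e. $u\in{\rm int}(C)$). Then the largest operator system $C^{\max}$ of $C$ admits a finite-dimensional realization if and only if $C$ is polyhedral.
   Context: ${\rm Her}_s(\mathbb C)$ denotes the Hermitian $s\times s$ matrices; $\geqslant 0$ denotes positive semidefiniteness. A convex cone $C$ is salient if $C\cap(-C)=\{0\}$. The largest operator system $C^{\max}=(C_s^{\max})_{s\ge1}$ of $C$ is $$C_s^{\max}:=\{(A_1,\ldots,A_d)\in{\rm Her}_s(\mathbb C)^d\mid (v^*A_1v,\ldots,v^*A_dv)\in C\ \text{ for all } v\in\mathbb C^s\},$$ with order unit $u$. It admits a finite-dimensional realization if for some $r$ there are $T_1,\ldots,T_d\in{\rm Her}_r(\mathbb C)$ with $\sum_iu_iT_i=I_r$ such that for all $s\ge1$ and all $A\in{\rm Her}_s(\mathbb C)^d$: $A\in C_s^{\max}\Leftrightarrow T_1\otimes A_1+\cdots+T_d\otimes A_d\geqslant0$. A cone is polyhedral if it is the intersection of finitely many closed linear half-spaces. *)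

theory Defs
  imports "HOL-Analysis.Analysis" "Jordan_Normal_Form.Schur_Decomposition"
begin

no_notation vec_nth (infixl "$" 90)
notation vec_nth (infixl "$h" 90)
no_notation inner (infix "\<bullet>" 70)
hide_const (open) Finite_Cartesian_Product.vec Finite_Cartesian_Product.mat

definition Her :: "nat \<Rightarrow> complex mat set" where
  "Her s = {A \<in> carrier_mat s s. mat_adjoint A = A}"

text \<open>The number \<open>v\<^sup>* A v\<close>, in which \<open>\<bullet>c\<close> conjugates its right argument.
  It is real for Hermitian \<open>A\<close> (lemma \<open>quad_form_Her_real\<close> below), so that
  \<^const>\<open>Re\<close> in the definitions below only changes the type.\<close>

definition quad_form :: "complex mat \<Rightarrow> complex vec \<Rightarrow> complex" where
  "quad_form A v = (A *\<^sub>v v) \<bullet>c v"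

definition psd :: "nat \<Rightarrow> complex mat \<Rightarrow> bool" where
  "psd n A \<longleftrightarrow> A \<in> Her n \<and> (\<forall>v\<in>carrier_vec n. Re (quad_form A v) \<ge> 0)"

definition kronecker :: "complex mat \<Rightarrow> complex mat \<Rightarrow> complex mat" (infixl "\<otimes>\<^sub>K" 75) where
  "A \<otimes>\<^sub>K B = Matrix.mat (dim_row A * dim_row B) (dim_col A * dim_col B)
     (\<lambda>(i, j). A $$ (i div dim_row B, j div dim_col B) * B $$ (i mod dim_row B, j mod dim_col B))"

text \<open>The type of all matrices is not an additive monoid, hence the explicit dimension.\<close>

definition mat_sum :: "nat \<Rightarrow> ('n::finite \<Rightarrow> complex mat) \<Rightarrow> complex mat" where
  "mat_sum n M = Matrix.mat n n (\<lambda>ab. \<Sum>i\<in>UNIV. M i $$ ab)"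

definition salient :: "'a::real_vector set \<Rightarrow> bool" where
  "salient C \<longleftrightarrow> C \<inter> uminus ` C = {0}"

text \<open>The library's \<^const>\<open>polyhedron\<close> allows affine half-spaces; here they are linear.\<close>

definition polyhedral_cone :: "'a::real_inner set \<Rightarrow> bool" where
  "polyhedral_cone C \<longleftrightarrow>
     (\<exists>F. finite F \<and> C = \<Inter>F \<and> (\<forall>H\<in>F. \<exists>a. a \<noteq> 0 \<and> H = {x. inner a x \<ge> 0}))"

text \<open>A \<open>d\<close>-tuple of matrices is a function on the index type \<open>'n\<close>, where \<open>d = CARD('n)\<close>.\<close>

definition max_system :: "(real ^ 'n) set \<Rightarrow> nat \<Rightarrow> ('n::finite \<Rightarrow> complex mat) set" where
  "max_system C s = {A. (\<forall>i. A i \<in> Her s) \<and>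
     (\<forall>v\<in>carrier_vec s. (\<chi> i. Re (quad_form (A i) v)) \<in> C)}"

definition fin_dim_realizable ::
    "(nat \<Rightarrow> ('n::finite \<Rightarrow> complex mat) set) \<Rightarrow> real ^ 'n \<Rightarrow> bool" where
  "fin_dim_realizable S u \<longleftrightarrow>
     (\<exists>r\<ge>1. \<exists>T. (\<forall>i. T i \<in> Her r) \<and>
        mat_sum r (\<lambda>i. complex_of_real (u $h i) \<cdot>\<^sub>m T i) = 1\<^sub>m r \<and>
        (\<forall>s\<ge>1. \<forall>A. (\<forall>i. A i \<in> Her s) \<longrightarrow>
           (A \<in> S s \<longleftrightarrow> psd (r * s) (mat_sum (r * s) (\<lambda>i. T i \<otimes>\<^sub>K A i)))))"

lemma quad_form_Her_real:
  assumes "A \<in> Her s" "v \<in> carrier_vec s"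
  shows "quad_form A v \<in> \<real>"
proof -
  have A: "A \<in> carrier_mat s s" and adj: "mat_adjoint A = A"
    using assms(1) by (auto simp: Her_def)
  have h: "A $$ (i, j) = cnj (A $$ (j, i))" if "i < s" "j < s" for i j
  proof -
    have "mat_adjoint A $$ (i, j) = cnj (A $$ (j, i))"
      using A that by (simp add: mat_adjoint_def mat_of_rows_def)
    then show ?thesis using adj by simp
  qed
  have q: "quad_form A v = (\<Sum>i<s. \<Sum>j<s. A $$ (i, j) * v $ j * cnj (v $ i))"
    using A assms(2)
    by (simp add: quad_form_def scalar_prod_def sum_distrib_right atLeast0LessThan)
  have "cnj (quad_form A v) = (\<Sum>i<s. \<Sum>j<s. A $$ (j, i) * v $ i * cnj (v $ j))"
    unfolding q cnj_sum
    by (intro sum.cong refl) (auto simp: h[symmetric] mult_ac)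
  also have "\<dots> = quad_form A v"
    unfolding q by (rule sum.swap)
  finally show ?thesis by (simp add: Reals_cnj_iff)
qed

end

theory Submission
  imports Defs
begin

text \<open>
  Let \<open>T\<close> realize the largest system, and let the base \<open>B\<close> of the dual cone consist of the functionals \<open>l\<close>
  with \<open>l \<ge> 0\<close> on \<open>C\<close> and \<open>l u = 1\<close>. Suppose \<open>p \<in> B\<close> is exposed with a quadratic margin: some \<open>a\<close>
  satisfies \<open>p a = 0\<close> and \<open>|l - p|\<^sup>2 \<le> 2 l a\<close> on \<open>B\<close>. The realization at size 1 gives a unit vector \<open>x\<close>
  with \<open>x\<^sup>* T(a) x = 0\<close>, and at size 2 it shows \<open>T(b) x = p(b) x\<close> for all \<open>b\<close>. Since
  the \<open>T(b)\<close> are Hermitian, different \<open>p\<close> have orthogonal eigenvectors, so there are at most \<open>r\<close> such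
  points. They cut out \<open>C\<close>, because every point outside \<open>C\<close> is separated by one of them: take the
  point of \<open>B\<close> farthest from a suitable centre. Conversely, the finitely many functionals
  that define a polyhedral cone, normalized at \<open>u\<close>, are the diagonal entries of a realization.
\<close>

section \<open>Coordinates of Kronecker sums and their quadratic forms\<close>

lemma sum_lessThan_mult:
  fixes f :: "nat \<Rightarrow> 'a::comm_monoid_add"
  shows "(\<Sum>k<r * s. f k) = (\<Sum>i<r. \<Sum>j<s. f (i * s + j))"
proof -
  have "(\<Sum>k<r * s. f k) = (\<Sum>i<r. sum f {i * s..<i * s + s})"
    by (rule sum.nat_group[symmetric])
  also have "\<dots> = (\<Sum>i<r. \<Sum>j<s. f (i * s + j))"
  proof (rule sum.cong)
    show "sum f {i * s..<i * s + s} = (\<Sum>j<s. f (i * s + j))" for i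
      using sum.shift_bounds_nat_ivl[of f 0 "i * s" s] by (simp add: add.commute atLeast0LessThan)
  qed simp
  finally show ?thesis .
qed

lemma mult_add_less_mult:
  fixes i j r s :: nat
  assumes "i < r" "j < s"
  shows "i * s + j < r * s"
proof -
  have "i * s + j < Suc i * s" using assms by simp
  also have "\<dots> \<le> r * s" using assms by (intro mult_le_mono1) simp
  finally show ?thesis .
qed

lemma Her_iff_index:
  "A \<in> Her s \<longleftrightarrow> A \<in> carrier_mat s s \<and> (\<forall>i<s. \<forall>j<s. A $$ (i, j) = cnj (A $$ (j, i)))"
proof -
  have adj: "mat_adjoint A $$ (i, j) = cnj (A $$ (j, i))"
    if "A \<in> carrier_mat s s" "i < s" "j < s" for i j
    using that by (simp add: mat_adjoint_def mat_of_rows_def)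
  have dim: "mat_adjoint A \<in> carrier_mat s s" if "A \<in> carrier_mat s s"
    using that by (simp add: mat_adjoint_def mat_of_rows_def)
  show ?thesis
  proof
    assume "A \<in> Her s"
    then show "A \<in> carrier_mat s s \<and> (\<forall>i<s. \<forall>j<s. A $$ (i, j) = cnj (A $$ (j, i)))"
      using adj unfolding Her_def by (metis (mono_tags, lifting) mem_Collect_eq)
  next
    assume *: "A \<in> carrier_mat s s \<and> (\<forall>i<s. \<forall>j<s. A $$ (i, j) = cnj (A $$ (j, i)))"
    have "mat_adjoint A = A"
    proof (rule eq_matI)
      show "mat_adjoint A $$ (i, j) = A $$ (i, j)" if "i < dim_row A" "j < dim_col A" for i j
        using * that adj[of i j] by (metis carrier_matD)
      show "dim_row (mat_adjoint A) = dim_row A" "dim_col (mat_adjoint A) = dim_col A"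
        using * dim by (metis carrier_matD)+
    qed
    with * show "A \<in> Her s" by (simp add: Her_def)
  qed
qed

lemma quad_form_eq_sum:
  assumes "A \<in> carrier_mat s s" "v \<in> carrier_vec s"
  shows "quad_form A v = (\<Sum>i<s. \<Sum>j<s. A $$ (i, j) * v $ j * cnj (v $ i))"
  using assms by (simp add: quad_form_def scalar_prod_def sum_distrib_right atLeast0LessThan)

lemma index_mat_sum_kronecker:
  assumes "\<And>n. T n \<in> carrier_mat r r" "\<And>n. A n \<in> carrier_mat s s"
    and "i < r" "i' < r" "j < s" "j' < s"
  shows "mat_sum (r * s) (\<lambda>n. T n \<otimes>\<^sub>K A n) $$ (i * s + j, i' * s + j') =
    (\<Sum>n\<in>UNIV. T n $$ (i, i') * A n $$ (j, j'))"
proof -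
  have "dim_row (A n) = s" "dim_col (A n) = s" "dim_row (T n) = r" "dim_col (T n) = r" for n
    using assms(1,2) by auto
  then show ?thesis
    using assms(3-) by (simp add: mat_sum_def kronecker_def mult_add_less_mult)
qed

lemma mat_sum_kronecker_Her:
  assumes "\<And>n. T n \<in> Her r" "\<And>n. A n \<in> Her s"
  shows "mat_sum (r * s) (\<lambda>n. T n \<otimes>\<^sub>K A n) \<in> Her (r * s)"
proof -
  have T: "T n \<in> carrier_mat r r" "i < r \<Longrightarrow> j < r \<Longrightarrow> cnj (T n $$ (j, i)) = T n $$ (i, j)"
   and A: "A n \<in> carrier_mat s s" "i < s \<Longrightarrow> j < s \<Longrightarrow> cnj (A n $$ (j, i)) = A n $$ (i, j)" for n i j
    using assms unfolding Her_iff_index by metis+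
  have "mat_sum (r * s) (\<lambda>n. T n \<otimes>\<^sub>K A n) $$ (k, l) =
      cnj (mat_sum (r * s) (\<lambda>n. T n \<otimes>\<^sub>K A n) $$ (l, k))" if "k < r * s" "l < r * s" for k l
  proof -
    have s: "0 < s" using that by (cases s) auto
    have "k div s < r" "l div s < r"
      using that by (simp_all add: less_mult_imp_div_less)
    then show ?thesis
      using index_mat_sum_kronecker[of T r A s "k div s" "l div s" "k mod s" "l mod s"]
        index_mat_sum_kronecker[of T r A s "l div s" "k div s" "l mod s" "k mod s"] T A s
      by simp
  qed
  then show ?thesis
    unfolding Her_iff_index by (simp add: mat_sum_def)
qed

lemma quad_form_mat_sum_kronecker:
  assumes T: "\<And>n. T n \<in> carrier_mat r r" and A: "\<And>n. A n \<in> carrier_mat s s"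
    and v: "v \<in> carrier_vec (r * s)"
  shows "quad_form (mat_sum (r * s) (\<lambda>n. T n \<otimes>\<^sub>K A n)) v =
    (\<Sum>i<r. \<Sum>j<s. \<Sum>i'<r. \<Sum>j'<s. (\<Sum>n\<in>UNIV. T n $$ (i, i') * A n $$ (j, j')) *
       v $ (i' * s + j') * cnj (v $ (i * s + j)))"
proof -
  have "mat_sum (r * s) (\<lambda>n. T n \<otimes>\<^sub>K A n) \<in> carrier_mat (r * s) (r * s)"
    by (simp add: mat_sum_def)
  then show ?thesis
    using v by (simp add: quad_form_eq_sum sum_lessThan_mult index_mat_sum_kronecker[OF T A])
qed

section \<open>The pencil \<open>T(b)\<close> as a sesquilinear form\<close>

text \<open>This is \<open>y\<^sup>* T(b) x\<close> with \<open>T(b) = \<Sum>\<^sub>n b\<^sub>n T\<^sub>n\<close>. Vectors are functions on \<open>nat\<close>, of which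
  only the first \<open>r\<close> values matter, so that the product topology supplies compactness.\<close>

definition pencil_form ::
    "nat \<Rightarrow> ('n::finite \<Rightarrow> complex mat) \<Rightarrow> real ^ 'n \<Rightarrow> (nat \<Rightarrow> complex) \<Rightarrow> (nat \<Rightarrow> complex) \<Rightarrow> complex"
  where "pencil_form r T b x y =
    (\<Sum>i<r. \<Sum>j<r. (\<Sum>n\<in>UNIV. of_real (b $h n) * T n $$ (i, j)) * x j * cnj (y i))"

text \<open>The vector is cut into \<open>s\<close> slices of stride \<open>s\<close>, slice
  \<open>k\<close> being \<open>\<lambda>i. v $ (i * s + k)\<close>. With the tensor factors
  exchanged, the Kronecker sum is an \<open>s\<close> by \<open>s\<close> block matrix with blocks
  \<open>T(a j k)\<close>.\<close>

lemma quad_form_kronecker_real: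
  assumes T: "\<And>n. T n \<in> carrier_mat r r" and v: "v \<in> carrier_vec (r * s)"
  shows "quad_form (mat_sum (r * s)
      (\<lambda>n. T n \<otimes>\<^sub>K Matrix.mat s s (\<lambda>(j, k). complex_of_real (a j k $h n)))) v =
    (\<Sum>j<s. \<Sum>k<s. pencil_form r T (a j k) (\<lambda>i. v $ (i * s + k)) (\<lambda>i. v $ (i * s + j)))"
proof -
  let ?f = "\<lambda>i j i' k. (\<Sum>n\<in>UNIV. of_real (a j k $h n) * T n $$ (i, i')) *
       v $ (i' * s + k) * cnj (v $ (i * s + j))"
  have "quad_form (mat_sum (r * s)
      (\<lambda>n. T n \<otimes>\<^sub>K Matrix.mat s s (\<lambda>(j, k). complex_of_real (a j k $h n)))) v =
      (\<Sum>i<r. \<Sum>j<s. \<Sum>i'<r. \<Sum>k<s. ?f i j i' k)"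
    by (simp add: quad_form_mat_sum_kronecker[OF T _ v] mult.commute)
  also have "\<dots> = (\<Sum>i<r. \<Sum>j<s. \<Sum>k<s. \<Sum>i'<r. ?f i j i' k)"
    by (intro sum.cong refl sum.swap)
  also have "\<dots> = (\<Sum>j<s. \<Sum>i<r. \<Sum>k<s. \<Sum>i'<r. ?f i j i' k)"
    by (rule sum.swap)
  also have "\<dots> = (\<Sum>j<s. \<Sum>k<s. \<Sum>i<r. \<Sum>i'<r. ?f i j i' k)"
    by (intro sum.cong refl sum.swap)
  finally show ?thesis
    by (simp add: pencil_form_def)
qed

lemma pencil_form_add: "pencil_form r T (a + b) x y = pencil_form r T a x y + pencil_form r T b x y"
  by (simp add: pencil_form_def sum.distrib distrib_right)

lemma pencil_form_scaleR: "pencil_form r T (c *\<^sub>R b) x y = of_real c * pencil_form r T b x y"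
proof -
  have *: "(\<Sum>n\<in>UNIV. of_real ((c *\<^sub>R b) $h n) * T n $$ ij) =
      of_real c * (\<Sum>n\<in>UNIV. of_real (b $h n) * T n $$ ij)" for ij
    by (simp add: sum_distrib_left mult.assoc)
  show ?thesis
    unfolding pencil_form_def * by (simp add: sum_distrib_left[of "of_real c" _ "{..<r}"] mult.assoc)
qed

lemma pencil_form_diff: "pencil_form r T (a - b) x y = pencil_form r T a x y - pencil_form r T b x y"
  using pencil_form_add[of r T "a - b" b] by simp

lemma pencil_form_mult_right: "pencil_form r T b x (\<lambda>i. c * y i) = cnj c * pencil_form r T b x y"
  by (simp add: pencil_form_def sum_distrib_left mult_ac)

lemma pencil_form_mult_left: "pencil_form r T b (\<lambda>i. c * x i) y = c * pencil_form r T b x y"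
  by (simp add: pencil_form_def sum_distrib_left mult_ac)

lemma cnj_pencil_form:
  assumes "\<And>n. T n \<in> Her r"
  shows "cnj (pencil_form r T b x y) = pencil_form r T b y x"
proof -
  have T: "i < r \<Longrightarrow> j < r \<Longrightarrow> cnj (T n $$ (i, j)) = T n $$ (j, i)" for n i j
    using assms unfolding Her_iff_index by metis
  have "cnj (pencil_form r T b x y) =
      (\<Sum>i<r. \<Sum>j<r. (\<Sum>n\<in>UNIV. of_real (b $h n) * T n $$ (j, i)) * y i * cnj (x j))"
    unfolding pencil_form_def cnj_sum
    by (intro sum.cong refl) (simp add: T mult_ac)
  also have "\<dots> = pencil_form r T b y x"
    unfolding pencil_form_def by (rule sum.swap)
  finally show ?thesis .
qed

lemma pencil_form_unit:
  assumes "mat_sum r (\<lambda>i. complex_of_real (u $h i) \<cdot>\<^sub>m T i) = 1\<^sub>m r"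
    and T: "\<And>n. T n \<in> carrier_mat r r"
  shows "pencil_form r T u x y = (\<Sum>i<r. x i * cnj (y i))"
proof -
  have "(\<Sum>n\<in>UNIV. of_real (u $h n) * T n $$ (i, j)) = of_bool (i = j)" if "i < r" "j < r" for i j
  proof -
    have "mat_sum r (\<lambda>i. complex_of_real (u $h i) \<cdot>\<^sub>m T i) $$ (i, j) =
        (\<Sum>n\<in>UNIV. of_real (u $h n) * T n $$ (i, j))"
      using that T carrier_matD[OF T] by (simp add: mat_sum_def)
    with assms(1) that show ?thesis by (simp add: of_bool_def)
  qed
  then have "pencil_form r T u x y = (\<Sum>i<r. \<Sum>j<r. of_bool (i = j) * x j * cnj (y i))"
    by (simp add: pencil_form_def)
  then show ?thesis
    by (simp add: of_bool_def if_distrib[of "\<lambda>a. a * _"] cong: if_cong)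
qed

section \<open>Counting orthonormal vectors\<close>

text \<open>Bessel's inequality is summed over the standard basis vectors: the left sides add up to
  \<open>card P\<close>, the right sides to \<open>r\<close>.\<close>

lemma finite_orthonormal_card_le:
  fixes x :: "'a \<Rightarrow> nat \<Rightarrow> complex"
  assumes "finite P"
    and orth: "\<And>p q. p \<in> P \<Longrightarrow> q \<in> P \<Longrightarrow> (\<Sum>i<r. x p i * cnj (x q i)) = of_bool (p = q)"
  shows "card P \<le> r"
proof -
  have bessel: "(\<Sum>p\<in>P. (cmod (x p k))\<^sup>2) \<le> 1" if k: "k < r" for k
  proof -
    define S where "S = (\<Sum>p\<in>P. (cmod (x p k))\<^sup>2)"
    \<comment> \<open>The orthogonal projection of the basis vector \<open>e_k\<close> onto the span
      of the family. \<open>S\<close> is both its squared length and its entry at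
      \<open>k\<close>.\<close>
    define y where "y i = (\<Sum>p\<in>P. cnj (x p k) * x p i)" for i
    have S: "of_real S = (\<Sum>p\<in>P. cnj (x p k) * x p k)"
      unfolding S_def of_real_sum complex_norm_square by (simp add: mult.commute)
    have "(\<Sum>i<r. y i * cnj (y i)) =
        (\<Sum>i<r. \<Sum>p\<in>P. \<Sum>q\<in>P. cnj (x p k) * x q k * (x p i * cnj (x q i)))"
      by (simp add: y_def sum_product mult_ac)
    also have "\<dots> = (\<Sum>p\<in>P. \<Sum>q\<in>P. \<Sum>i<r. cnj (x p k) * x q k * (x p i * cnj (x q i)))"
      by (subst sum.swap) (intro sum.cong refl sum.swap)
    also have "\<dots> = (\<Sum>p\<in>P. \<Sum>q\<in>P. cnj (x p k) * x q k * of_bool (p = q))"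
      by (intro sum.cong refl) (simp add: orth flip: sum_distrib_left)
    also have "\<dots> = of_real S"
      using assms(1) by (simp add: S of_bool_def if_distrib cong: if_cong)
    finally have yy: "(\<Sum>i<r. y i * cnj (y i)) = of_real S" .
    have yk: "y k = of_real S" by (simp add: y_def S)
    \<comment> \<open>The squared distance from \<open>e_k\<close> to \<open>y\<close> is
      \<open>1 - S\<close>, which bounds \<open>S\<close> by 1.\<close>
    have "of_real (\<Sum>i<r. (cmod (of_bool (i = k) - y i))\<^sup>2) =
        (\<Sum>i<r. (of_bool (i = k) - y i) * cnj (of_bool (i = k) - y i))"
      by (simp only: of_real_sum complex_norm_square)
    also have "\<dots> = (\<Sum>i<r. (if i = k then 1 - y i - cnj (y i) else 0) + y i * cnj (y i))"
      by (intro sum.cong refl) (simp add: algebra_simps)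
    also have "\<dots> = 1 - of_real S"
      using k by (simp add: sum.distrib yy yk)
    finally have "complex_of_real (\<Sum>i<r. (cmod (of_bool (i = k) - y i))\<^sup>2) = of_real (1 - S)"
      by simp
    then have "(\<Sum>i<r. (cmod (of_bool (i = k) - y i))\<^sup>2) = 1 - S"
      by (simp only: of_real_eq_iff)
    moreover have "0 \<le> (\<Sum>i<r. (cmod (of_bool (i = k) - y i))\<^sup>2)"
      by (rule sum_nonneg) simp
    ultimately show ?thesis
      by (simp add: S_def)
  qed
  have "real (card P) = (\<Sum>p\<in>P. \<Sum>k<r. (cmod (x p k))\<^sup>2)"
  proof -
    have "(\<Sum>k<r. (cmod (x p k))\<^sup>2) = 1" if "p \<in> P" for p
    proof -
      have "complex_of_real (\<Sum>k<r. (cmod (x p k))\<^sup>2) = 1"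
        using orth[OF that that] by (simp only: of_real_sum complex_norm_square) simp
      then show ?thesis by (simp only: of_real_eq_1_iff)
    qed
    then show ?thesis by simp
  qed
  also have "\<dots> = (\<Sum>k<r. \<Sum>p\<in>P. (cmod (x p k))\<^sup>2)" by (rule sum.swap)
  also have "\<dots> \<le> (\<Sum>k<r. 1)" by (intro sum_mono bessel) simp
  finally show ?thesis by simp
qed

section \<open>The base of the dual cone and its exposed points\<close>

definition dual_base :: "'a::real_inner set \<Rightarrow> 'a \<Rightarrow> 'a set" where
  "dual_base C u = {l. (\<forall>a\<in>C. 0 \<le> inner l a) \<and> inner l u = 1}"

text \<open>A step of length \<open>e\<close> from \<open>u\<close> against the direction of
  \<open>l\<close> stays in \<open>C\<close>, so \<open>l\<close> is still nonnegative there. The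
  bound makes the base compact and makes every nonzero functional of the dual cone positive at
  \<open>u\<close>.\<close>

lemma dual_cone_norm_bound:
  fixes u :: "'a::real_inner"
  assumes "u \<in> interior C"
  obtains e where "0 < e" "\<And>l. (\<And>a. a \<in> C \<Longrightarrow> 0 \<le> inner l a) \<Longrightarrow> e * norm l \<le> inner l u"
proof -
  obtain e where e: "0 < e" "cball u e \<subseteq> C"
    using assms mem_interior_cball by blast
  have "e * norm l \<le> inner l u" if l: "\<And>a. a \<in> C \<Longrightarrow> 0 \<le> inner l a" for l
  proof -
    \<comment> \<open>For \<open>l = 0\<close> the quotient is 0 and the point is \<open>u\<close>
      itself.\<close>
    have "u - (e / norm l) *\<^sub>R l \<in> cball u e"
      using e by (simp add: dist_norm)
    then have "0 \<le> inner l (u - (e / norm l) *\<^sub>R l)"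
      using e l by blast
    then show ?thesis
      by (simp add: inner_diff_right power2_norm_eq_inner[symmetric] power2_eq_square split: if_splits)
  qed
  with e that show ?thesis by blast
qed

lemma compact_dual_base:
  fixes u :: "'a::euclidean_space"
  assumes "u \<in> interior C"
  shows "compact (dual_base C u)"
proof -
  obtain e where e: "0 < e" "\<And>l. (\<And>a. a \<in> C \<Longrightarrow> 0 \<le> inner l a) \<Longrightarrow> e * norm l \<le> inner l u"
    using dual_cone_norm_bound[OF assms] by blast
  have "bounded (dual_base C u)"
    unfolding bounded_iff
  proof (intro exI ballI)
    fix l assume "l \<in> dual_base C u"
    then have "e * norm l \<le> 1" using e(2)[of l] by (auto simp: dual_base_def)
    then show "norm l \<le> 1 / e" using e(1) by (simp add: field_simps)
  qed
  moreover have "dual_base C u = (\<Inter>a\<in>C. {l. 0 \<le> inner l a}) \<inter> {l. inner l u = 1}"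
    by (auto simp: dual_base_def)
  then have "closed (dual_base C u)"
    by (auto intro!: closed_Int closed_INT closed_Collect_le closed_Collect_eq continuous_intros)
  ultimately show ?thesis
    by (simp add: compact_eq_bounded_closed)
qed

text \<open>The bipolar theorem. A separating functional is nonnegative on the cone, hence positive
  at \<open>u\<close>, and can be rescaled into the base.\<close>

lemma mem_cone_iff_dual_base:
  fixes u :: "'a::euclidean_space"
  assumes C: "closed C" "convex C" "cone C" and u: "u \<in> interior C"
  shows "a \<in> C \<longleftrightarrow> (\<forall>l\<in>dual_base C u. 0 \<le> inner l a)"
proof
  show "\<forall>l\<in>dual_base C u. 0 \<le> inner l a" if "a \<in> C"
    using that by (simp add: dual_base_def)
next
  assume nonneg: "\<forall>l\<in>dual_base C u. 0 \<le> inner l a"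
  show "a \<in> C"
  proof (rule ccontr)
    assume "a \<notin> C"
    then obtain l b where l: "inner l a < b" "\<And>x. x \<in> C \<Longrightarrow> b < inner l x"
      using separating_hyperplane_closed_point[of C a] C by blast
    have "u \<in> C" using u interior_subset by blast
    then have "0 \<in> C" using C(3) cone_contains_0 by blast
    then have "b < 0" using l(2)[of 0] by simp
    have nn: "0 \<le> inner l x" if "x \<in> C" for x
    proof (rule ccontr)
      assume neg: "\<not> 0 \<le> inner l x"
      \<comment> \<open>On this positive multiple of \<open>x\<close> the functional takes exactly
        the value \<open>b\<close>, against the strict separation.\<close>
      have "(b / inner l x) *\<^sub>R x \<in> C"
        using neg \<open>b < 0\<close> that C(3) by (intro mem_cone) (auto simp: divide_nonpos_neg)
      from l(2)[OF this] show False using neg by simp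
    qed
    obtain e where e: "0 < e" "e * norm l \<le> inner l u"
      using dual_cone_norm_bound[OF u] nn by metis
    have "l \<noteq> 0" using l(1) \<open>b < 0\<close> by auto
    then have pos: "0 < inner l u" using e by (smt (verit) mult_pos_pos zero_less_norm_iff)
    then have "(1 / inner l u) *\<^sub>R l \<in> dual_base C u"
      using nn by (simp add: dual_base_def)
    with nonneg have "0 \<le> inner ((1 / inner l u) *\<^sub>R l) a" by blast
    with pos l(1) \<open>b < 0\<close> show False by (simp add: zero_le_divide_iff)
  qed
qed

text \<open>The separating functional \<open>p\<close> is a point of the base farthest from a centre \<open>c\<close> far out in
  the direction of \<open>a0\<close>. A farthest point is exposed with a quadratic margin.\<close>

lemma exposed_dual_base_point:
  fixes u :: "'a::euclidean_space"
  assumes C: "closed C" "convex C" "cone C" and u: "u \<in> interior C" and a0: "a0 \<notin> C"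
  obtains p a where "p \<in> dual_base C u" "inner p a0 < 0" "inner p a = 0"
    "\<And>l. l \<in> dual_base C u \<Longrightarrow> (norm (l - p))\<^sup>2 \<le> 2 * inner l a"
proof -
  let ?B = "dual_base C u"
  obtain l0 where l0: "l0 \<in> ?B" "inner l0 a0 < 0"
    using mem_cone_iff_dual_base[OF C u] a0 by (meson not_le)
  obtain K where K: "\<And>l. l \<in> ?B \<Longrightarrow> norm l \<le> K"
    using compact_imp_bounded[OF compact_dual_base[OF u]] unfolding bounded_iff by blast
  \<comment> \<open>With this distance the gain \<open>- 2 * R * inner l0 a0\<close> of
    \<open>l0\<close> exceeds \<open>K\<^sup>2\<close>, the most that the norm of \<open>p\<close>
    can contribute; so the farthest point is also negative at \<open>a0\<close>.\<close>
  define R where "R = (K\<^sup>2 + 1) / (- 2 * inner l0 a0)"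
  have R: "0 < R" "R * (- 2 * inner l0 a0) = K\<^sup>2 + 1"
    using l0(2) by (simp_all add: R_def add_nonneg_pos divide_pos_neg mult_pos_neg)
  define c where "c = R *\<^sub>R a0"
  obtain p where p: "p \<in> ?B" "\<And>l. l \<in> ?B \<Longrightarrow> norm (l - c) \<le> norm (p - c)"
    using continuous_attains_sup[OF compact_dual_base[OF u] _
        continuous_on_norm[OF continuous_on_diff[OF continuous_on_id continuous_on_const]], of c] l0(1)
    by blast
  have far: "(norm (l - c))\<^sup>2 \<le> (norm (p - c))\<^sup>2" if "l \<in> ?B" for l
    using p(2)[OF that] by simp
  have expand: "(norm (l - c))\<^sup>2 = (norm l)\<^sup>2 - 2 * R * inner l a0 + (norm c)\<^sup>2" for l
    unfolding power2_norm_eq_inner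
    by (simp add: c_def algebra_simps inner_commute power2_eq_square)
  have "(norm p)\<^sup>2 \<le> K\<^sup>2" using K[OF p(1)] by (intro power_mono) auto
  moreover have "- 2 * (R * inner l0 a0) = K\<^sup>2 + 1"
    using R(2) by (simp add: mult_ac)
  ultimately have "R * inner p a0 < 0"
    using far[OF l0(1)] zero_le_power2[of "norm l0"] unfolding expand mult.assoc by linarith
  then have neg: "inner p a0 < 0" using R(1) by (simp add: mult_less_0_iff)
  \<comment> \<open>On the base, subtracting a multiple of \<open>u\<close> subtracts a constant;
    this one makes \<open>a\<close> vanish at \<open>p\<close>.\<close>
  define a where "a = (c - p) - inner (c - p) p *\<^sub>R u"
  have unit: "inner l u = 1" if "l \<in> ?B" for l
    using that by (simp add: dual_base_def)
  have inner_a: "inner l a = inner (l - p) (c - p)" if "l \<in> ?B" for l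
    using unit[OF that] by (simp add: a_def inner_diff_right inner_diff_left inner_commute)
  have "(norm (l - p))\<^sup>2 \<le> 2 * inner l a" if "l \<in> ?B" for l
  proof -
    \<comment> \<open>Expanding the distance to \<open>c\<close> around \<open>p\<close> turns
      maximality of \<open>p\<close> into the quadratic margin.\<close>
    have "l - c = (l - p) - (c - p)" by simp
    then have "(norm (l - c))\<^sup>2 = (norm (l - p))\<^sup>2 - 2 * inner (l - p) (c - p) + (norm (c - p))\<^sup>2"
      by (simp only: power2_norm_eq_inner inner_diff_left inner_diff_right inner_commute) simp
    with far[OF that] show ?thesis
      unfolding inner_a[OF that] norm_minus_commute[of p c] by linarith
  qed
  moreover have "inner p a = 0"
    using inner_a[OF p(1)] by simp
  ultimately show ?thesis using that[OF p(1) neg] by blast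
qed

section \<open>The smallest value of a pencil form on the unit sphere\<close>

lemma pencil_form_cong:
  assumes "\<And>i. i < r \<Longrightarrow> x i = x' i" "\<And>i. i < r \<Longrightarrow> y i = y' i"
  shows "pencil_form r T b x y = pencil_form r T b x' y'"
  unfolding pencil_form_def by (intro sum.cong refl) (simp add: assms)

lemma compact_PiE_UNIV:
  fixes S :: "'a \<Rightarrow> 'b::topological_space set"
  assumes "\<And>i. compact (S i)"
  shows "compact (PiE UNIV S)"
  using assms compactin_PiE[of "\<lambda>_. euclidean" UNIV S]
  by (simp add: euclidean_product_topology)

lemma continuous_on_apply_const [continuous_intros]:
  "continuous_on S (\<lambda>x. x i)"
  by (rule continuous_on_subset[OF continuous_on_product_coordinates]) simp

text \<open>The Rayleigh quotient has a minimizer because the unit sphere is compact; homogeneity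
  extends the inequality to all vectors.\<close>

lemma pencil_form_attains_min:
  assumes "1 \<le> r"
  obtains x where "(\<Sum>i<r. (cmod (x i))\<^sup>2) = 1"
    "\<And>y. Re (pencil_form r T a x x) * (\<Sum>i<r. (cmod (y i))\<^sup>2) \<le> Re (pencil_form r T a y y)"
proof -
  \<comment> \<open>Entries from \<open>r\<close> on are fixed to 0, so that the sphere lies in a
    product of compact sets.\<close>
  define K :: "(nat \<Rightarrow> complex) set" where "K = PiE UNIV (\<lambda>i. if i < r then cball 0 1 else {0})"
  define S where "S = K \<inter> {x. (\<Sum>i<r. (cmod (x i))\<^sup>2) = 1}"
  have "compact K"
    unfolding K_def by (rule compact_PiE_UNIV) auto
  moreover have "closed {x :: nat \<Rightarrow> complex. (\<Sum>i<r. (cmod (x i))\<^sup>2) = 1}"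
    by (intro closed_Collect_eq continuous_intros)
  ultimately have "compact S"
    unfolding S_def by (rule compact_Int_closed)
  moreover have "(\<lambda>i. of_bool (i = 0)) \<in> S"
  proof -
    have "(\<Sum>i<r. (cmod (of_bool (i = 0)))\<^sup>2) = (\<Sum>i<r. if i = 0 then 1 else 0)"
      by (intro sum.cong refl) simp
    then show ?thesis using assms by (auto simp: S_def K_def)
  qed
  moreover have "continuous_on S (\<lambda>x. Re (pencil_form r T a x x))"
    unfolding pencil_form_def by (intro continuous_intros)
  ultimately obtain x where x: "x \<in> S"
    "\<And>z. z \<in> S \<Longrightarrow> Re (pencil_form r T a x x) \<le> Re (pencil_form r T a z z)"
    using continuous_attains_inf[of S "\<lambda>x. Re (pencil_form r T a x x)"] by blast
  have "Re (pencil_form r T a x x) * (\<Sum>i<r. (cmod (y i))\<^sup>2) \<le> Re (pencil_form r T a y y)" for y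
  proof -
    define N where "N = (\<Sum>i<r. (cmod (y i))\<^sup>2)"
    have "0 \<le> N" unfolding N_def by (intro sum_nonneg) simp
    show ?thesis
    proof (cases "N = 0")
      case True
      then have "y i = 0" if "i < r" for i
        using that by (simp add: N_def sum_nonneg_eq_0_iff)
      then have "pencil_form r T a y y = 0" by (simp add: pencil_form_def)
      then show ?thesis using True by (simp add: N_def)
    next
      case False
      define c where "c = complex_of_real (1 / sqrt N)"
      \<comment> \<open>The normalized \<open>y\<close>, truncated so as to lie in \<open>K\<close>;
        the form ignores the entries cut off.\<close>
      define z where "z i = (if i < r then c * y i else 0)" for i
      have c: "(cmod c)\<^sup>2 = 1 / N" "c * cnj c = of_real (1 / N)"
        using False \<open>0 \<le> N\<close> 
        by (simp_all add: c_def power_divide real_sqrt_mult_self flip: of_real_mult of_real_divide)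
      have sum1: "(\<Sum>i<r. (cmod (z i))\<^sup>2) = 1"
      proof -
        have "(\<Sum>i<r. (cmod (z i))\<^sup>2) = (1 / N) * N"
          unfolding N_def sum_distrib_left
          by (intro sum.cong refl) (simp add: z_def norm_mult power_mult_distrib c N_def)
        then show ?thesis using False by simp
      qed
      have "cmod (z i) \<le> 1" if "i < r" for i
      proof -
        have "(cmod (z i))\<^sup>2 \<le> (\<Sum>i<r. (cmod (z i))\<^sup>2)"
          using that by (intro member_le_sum) auto
        then show ?thesis using sum1 by (simp add: abs_square_le_1)
      qed
      then have "z \<in> S" using sum1 by (auto simp: S_def K_def) (simp add: z_def)
      moreover have "pencil_form r T a z z = pencil_form r T a (\<lambda>i. c * y i) (\<lambda>i. c * y i)"
        by (rule pencil_form_cong) (simp_all add: z_def)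
      then have "pencil_form r T a z z = of_real (1 / N) * pencil_form r T a y y"
        using c(2) by (simp only: pencil_form_mult_left pencil_form_mult_right)
          (simp add: mult.assoc[symmetric])
      ultimately have "Re (pencil_form r T a x x) \<le> Re (pencil_form r T a y y) / N"
        using x(2)[of z] by (simp del: of_real_divide)
      then show ?thesis
        using False \<open>0 \<le> N\<close> by (simp add: N_def[symmetric] field_simps)
    qed
  qed
  moreover have "(\<Sum>i<r. (cmod (x i))\<^sup>2) = 1" using x(1) by (simp add: S_def)
  ultimately show ?thesis using that by blast
qed

section \<open>From a realization to finitely many joint eigenvalues\<close>

text \<open>A tuple of real symmetric matrices is read as one symmetric matrix \<open>m\<close> with
  entries in the space of \<open>C\<close>. This restates the realization without matrices; it is
  applied at sizes 1 and 2.\<close>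

lemma real_mat_realization_iff:
  fixes T :: "'n::finite \<Rightarrow> complex mat" and m :: "nat \<Rightarrow> nat \<Rightarrow> real ^ 'n"
  assumes T: "\<And>i. T i \<in> Her r"
    and real: "\<And>s A. 1 \<le> s \<Longrightarrow> (\<And>i. A i \<in> Her s) \<Longrightarrow>
      A \<in> max_system C s \<longleftrightarrow> psd (r * s) (mat_sum (r * s) (\<lambda>i. T i \<otimes>\<^sub>K A i))"
    and s: "1 \<le> s" and sym: "\<And>j k. m j k = m k j"
  shows "(\<forall>v. (\<Sum>j<s. \<Sum>k<s. Re (v k * cnj (v j)) *\<^sub>R m j k) \<in> C) \<longleftrightarrow>
    (\<forall>w. 0 \<le> Re (\<Sum>j<s. \<Sum>k<s. pencil_form r T (m j k) (w k) (w j)))"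
proof -
  have Tc: "T n \<in> carrier_mat r r" for n using T[of n] by (simp add: Her_def)
  define A where "A n = Matrix.mat s s (\<lambda>(j, k). complex_of_real (m j k $h n))" for n
  have A: "A n \<in> Her s" for n
    unfolding Her_iff_index A_def using sym by simp
  have Ac: "A n \<in> carrier_mat s s" for n by (simp add: A_def)
  have val: "(\<chi> n. Re (quad_form (A n) v)) = (\<Sum>j<s. \<Sum>k<s. Re (v $ k * cnj (v $ j)) *\<^sub>R m j k)"
    if "v \<in> carrier_vec s" for v
  proof -
    have "Re (quad_form (A n) v) = (\<Sum>j<s. \<Sum>k<s. Re (v $ k * cnj (v $ j)) * m j k $h n)" for n
      unfolding quad_form_eq_sum[OF Ac that] Re_sum
      by (intro sum.cong refl) (simp add: A_def algebra_simps)
    then show ?thesis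
      unfolding Finite_Cartesian_Product.vec_eq_iff by (simp only: vec_lambda_beta sum_component vector_scaleR_component) simp
  qed
  have mem: "A \<in> max_system C s \<longleftrightarrow> (\<forall>v. (\<Sum>j<s. \<Sum>k<s. Re (v k * cnj (v j)) *\<^sub>R m j k) \<in> C)"
  proof
    assume *: "A \<in> max_system C s"
    show "\<forall>v. (\<Sum>j<s. \<Sum>k<s. Re (v k * cnj (v j)) *\<^sub>R m j k) \<in> C"
    proof
      fix v :: "nat \<Rightarrow> complex"
      have "(\<chi> n. Re (quad_form (A n) (Matrix.vec s v))) \<in> C"
        using * by (simp add: max_system_def)
      then show "(\<Sum>j<s. \<Sum>k<s. Re (v k * cnj (v j)) *\<^sub>R m j k) \<in> C"
        by (simp add: val)
    qed
  next
    assume "\<forall>v. (\<Sum>j<s. \<Sum>k<s. Re (v k * cnj (v j)) *\<^sub>R m j k) \<in> C"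
    then show "A \<in> max_system C s"
      using A by (simp add: max_system_def val)
  qed
  let ?M = "mat_sum (r * s) (\<lambda>i. T i \<otimes>\<^sub>K A i)"
  have form: "quad_form ?M v =
      (\<Sum>j<s. \<Sum>k<s. pencil_form r T (m j k) (\<lambda>i. v $ (i * s + k)) (\<lambda>i. v $ (i * s + j)))"
    if "v \<in> carrier_vec (r * s)" for v
    unfolding A_def by (rule quad_form_kronecker_real[OF Tc that])
  have "psd (r * s) ?M \<longleftrightarrow>
    (\<forall>w. 0 \<le> Re (\<Sum>j<s. \<Sum>k<s. pencil_form r T (m j k) (w k) (w j)))"
  proof
    assume psd: "psd (r * s) ?M"
    show "\<forall>w. 0 \<le> Re (\<Sum>j<s. \<Sum>k<s. pencil_form r T (m j k) (w k) (w j))"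
    proof
      fix w :: "nat \<Rightarrow> nat \<Rightarrow> complex"
      \<comment> \<open>Interleaves the vectors: entry \<open>i * s + j\<close> is entry
        \<open>i\<close> of \<open>w j\<close>.\<close>
      define v where "v = Matrix.vec (r * s) (\<lambda>l. w (l mod s) (l div s))"
      have v: "v \<in> carrier_vec (r * s)" by (simp add: v_def)
      have "v $ (i * s + j) = w j i" if "i < r" "j < s" for i j
        using that by (simp add: v_def mult_add_less_mult)
      then have "quad_form ?M v = (\<Sum>j<s. \<Sum>k<s. pencil_form r T (m j k) (w k) (w j))"
        unfolding form[OF v] by (intro sum.cong refl pencil_form_cong) simp_all
      then show "0 \<le> Re (\<Sum>j<s. \<Sum>k<s. pencil_form r T (m j k) (w k) (w j))"
        using psd v unfolding psd_def by metis
    qed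
  next
    assume nonneg: "\<forall>w. 0 \<le> Re (\<Sum>j<s. \<Sum>k<s. pencil_form r T (m j k) (w k) (w j))"
    have "0 \<le> Re (quad_form ?M v)" if "v \<in> carrier_vec (r * s)" for v
      unfolding form[OF that] using nonneg[rule_format, of "\<lambda>k i. v $ (i * s + k)"] by simp
    then show "psd (r * s) ?M"
      using mat_sum_kronecker_Her[OF T A] by (simp add: psd_def)
  qed
  with mem real[OF s A] show ?thesis by simp
qed

text \<open>Every exposed point \<open>p\<close> of the dual base is the vector of joint eigenvalues of \<open>T\<close> at some \<open>x\<close>:
  \<open>x\<close> lies in the kernel of \<open>T a\<close>, and for \<open>b\<close> orthogonal to \<open>p\<close> the real symmetric matrix
  with rows \<open>(2 |b|\<^sup>2 a, b)\<close> and \<open>(b, u)\<close> belongs to the maximal system, by the quadratic margin.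
  Positivity at \<open>(x, y)\<close> for all \<open>y\<close> then forces \<open>T b x = 0\<close>.\<close>

lemma exposed_point_joint_eigenvalue:
  fixes T :: "'n::finite \<Rightarrow> complex mat" and u :: "real ^ 'n"
  assumes C: "closed C" "convex C" "cone C" and u: "u \<in> interior C"
    and r: "1 \<le> r" and T: "\<And>i. T i \<in> Her r"
    and unit: "mat_sum r (\<lambda>i. complex_of_real (u $h i) \<cdot>\<^sub>m T i) = 1\<^sub>m r"
    and real: "\<And>s A. 1 \<le> s \<Longrightarrow> (\<And>i. A i \<in> Her s) \<Longrightarrow>
      A \<in> max_system C s \<longleftrightarrow> psd (r * s) (mat_sum (r * s) (\<lambda>i. T i \<otimes>\<^sub>K A i))"
    and p: "p \<in> dual_base C u" and pa: "inner p a = 0"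
    and margin: "\<And>l. l \<in> dual_base C u \<Longrightarrow> (norm (l - p))\<^sup>2 \<le> 2 * inner l a"
  obtains x where "(\<Sum>i<r. (cmod (x i))\<^sup>2) = 1"
    "\<And>b y. pencil_form r T b x y = of_real (inner p b) * (\<Sum>i<r. x i * cnj (y i))"
proof -
  have Tc: "T n \<in> carrier_mat r r" for n using T[of n] by (simp add: Her_def)
  note base = mem_cone_iff_dual_base[OF C u]
  have form_u: "pencil_form r T u x y = (\<Sum>i<r. x i * cnj (y i))" for x y
    by (rule pencil_form_unit[OF unit Tc])
  have norm2: "Re (pencil_form r T u y y) = (\<Sum>i<r. (cmod (y i))\<^sup>2)" for y
    unfolding form_u Re_sum by (intro sum.cong refl) (simp add: complex_norm_square[symmetric] del: of_real_power flip: of_real_power)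
  \<comment> \<open>The realization at size 1, where only nonnegative multiples of \<open>b\<close>
    have to be in \<open>C\<close>.\<close>
  have cone_iff: "b \<in> C \<longleftrightarrow> (\<forall>x. 0 \<le> Re (pencil_form r T b x x))" for b
  proof -
    have "(\<forall>v. Re (v (0::nat) * cnj (v 0)) *\<^sub>R b \<in> C) \<longleftrightarrow> b \<in> C" (is "?L \<longleftrightarrow> _")
    proof
      assume ?L
      from this[rule_format, of "\<lambda>_. 1"] show "b \<in> C" by simp
    next
      assume "b \<in> C"
      then show ?L using C(3) by (auto intro!: mem_cone)
    qed
    moreover have "(\<forall>w. 0 \<le> Re (pencil_form r T b (w (0::nat)) (w 0))) \<longleftrightarrow>
        (\<forall>x. 0 \<le> Re (pencil_form r T b x x))"
    proof (intro iffI allI)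
      assume *: "\<forall>w. 0 \<le> Re (pencil_form r T b (w (0::nat)) (w 0))"
      show "0 \<le> Re (pencil_form r T b x x)" for x
        using *[rule_format, of "\<lambda>_. x"] .
    qed blast
    ultimately show ?thesis
      using real_mat_realization_iff[OF T real order.refl, of "\<lambda>_ _. b"] by simp
  qed
  obtain x where x: "(\<Sum>i<r. (cmod (x i))\<^sup>2) = 1"
    "\<And>y. Re (pencil_form r T a x x) * (\<Sum>i<r. (cmod (y i))\<^sup>2) \<le> Re (pencil_form r T a y y)"
    using pencil_form_attains_min[OF r, of T a] by metis
  have "0 \<le> inner l a" if "l \<in> dual_base C u" for l
    using margin[OF that] zero_le_power2[of "norm (l - p)"] by linarith
  then have "a \<in> C" by (simp add: base)
  have kernel: "Re (pencil_form r T a x x) = 0"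
  proof -
    define \<mu> where "\<mu> = Re (pencil_form r T a x x)"
    \<comment> \<open>As \<open>\<mu>\<close> is the minimum on the unit sphere,
      \<open>T(a) - \<mu> I\<close> is positive semidefinite. Evaluating at \<open>p\<close>, where
      \<open>a\<close> vanishes, gives \<open>\<mu> \<le> 0\<close>.\<close>
    have "a - \<mu> *\<^sub>R u \<in> C"
      unfolding cone_iff using x(2) by (simp add: pencil_form_diff pencil_form_scaleR norm2 \<mu>_def)
    then have "0 \<le> inner p (a - \<mu> *\<^sub>R u)" using p base by blast
    moreover have "inner p u = 1" using p by (simp add: dual_base_def)
    ultimately have "\<mu> \<le> 0" using pa by (simp add: inner_diff_right)
    moreover have "0 \<le> \<mu>" using \<open>a \<in> C\<close> by (simp add: cone_iff \<mu>_def)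
    ultimately show ?thesis by (simp add: \<mu>_def)
  qed
  have zero_Re: "Re (pencil_form r T b x y) = 0" if pb: "inner p b = 0" for b y
  proof -
    define m where "m j k = (if j = 0 \<and> k = 0 then (2 * (norm b)\<^sup>2) *\<^sub>R a
      else if j \<noteq> 0 \<and> k \<noteq> 0 then u else b)" for j k :: nat
    have m: "m 0 0 = (2 * (norm b)\<^sup>2) *\<^sub>R a" "m 0 1 = b" "m 1 0 = b" "m 1 1 = u"
      by (simp_all add: m_def)
    have sum2: "(\<Sum>j<(2::nat). f j) = f 0 + f 1" for f :: "nat \<Rightarrow> 'c::comm_monoid_add"
      by (simp add: numeral_2_eq_2)
    have "(\<Sum>j<(2::nat). \<Sum>k<2. Re (v k * cnj (v j)) *\<^sub>R m j k) \<in> C" for v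
      unfolding base
    proof
      fix l assume l: "l \<in> dual_base C u"
      define q where "q = inner l b"
      \<comment> \<open>Cauchy-Schwarz and the margin give the determinant condition for the real 2
        by 2 matrix obtained by applying \<open>l\<close>; the factor
        \<open>2 * (norm b)\<^sup>2\<close> in \<open>m\<close> comes from here.\<close>
      have "q = inner (l - p) b" by (simp add: q_def inner_diff_left pb)
      then have "\<bar>q\<bar> \<le> norm (l - p) * norm b" by (simp add: Cauchy_Schwarz_ineq2)
      then have "\<bar>q\<bar>\<^sup>2 \<le> (norm (l - p) * norm b)\<^sup>2" by (intro power_mono) auto
      also have "\<dots> \<le> 2 * inner l a * (norm b)\<^sup>2"
        unfolding power_mult_distrib by (intro mult_right_mono margin[OF l]) simp
      finally have q2: "q\<^sup>2 \<le> 2 * (norm b)\<^sup>2 * inner l a" by (simp add: mult_ac)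
      \<comment> \<open>Completes the square in the quadratic form of that matrix.\<close>
      define z where "z = of_real q * v 0 + v 1"
      have "0 \<le> Re (z * cnj z)" by simp
      also have "\<dots> = (cmod (v 0))\<^sup>2 * q\<^sup>2 + 2 * q * Re (v 1 * cnj (v 0)) + (cmod (v 1))\<^sup>2"
        unfolding cmod_power2 by (simp add: z_def algebra_simps power2_eq_square)
      also have "\<dots> \<le> (cmod (v 0))\<^sup>2 * (2 * (norm b)\<^sup>2 * inner l a)
          + 2 * q * Re (v 1 * cnj (v 0)) + (cmod (v 1))\<^sup>2"
        using q2 by (intro add_right_mono mult_left_mono) auto
      also have "\<dots> = inner l (\<Sum>j<(2::nat). \<Sum>k<2. Re (v k * cnj (v j)) *\<^sub>R m j k)"
      proof -
        have "inner l u = 1" using l by (simp add: dual_base_def)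
        then show ?thesis
          unfolding sum2 m inner_add_right inner_scaleR_right q_def[symmetric] cmod_power2
          by (simp add: algebra_simps power2_eq_square)
      qed
      finally show "0 \<le> inner l (\<Sum>j<(2::nat). \<Sum>k<2. Re (v k * cnj (v j)) *\<^sub>R m j k)" .
    qed
    moreover have "m j k = m k j" for j k by (simp add: m_def)
    ultimately have nonneg:
      "0 \<le> Re (\<Sum>j<2. \<Sum>k<2. pencil_form r T (m j k) (w k) (w j))" for w
      using real_mat_realization_iff[OF T real, of 2 m] by simp
    define h where "h = Re (pencil_form r T b x y)"
    define N where "N = (\<Sum>i<r. (cmod (y i))\<^sup>2)"
    have N: "0 \<le> N" unfolding N_def by (intro sum_nonneg) simp
    \<comment> \<open>Positivity at the pair of \<open>x\<close> and \<open>t * y\<close>: the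
      corner term drops out because the form of \<open>a\<close> vanishes at
      \<open>x\<close>.\<close>
    have quadratic: "0 \<le> 2 * t * h + t\<^sup>2 * N" for t
    proof -
      have "Re (pencil_form r T b y x) = h"
        unfolding h_def cnj_pencil_form[OF T, of _ b x y, symmetric] by simp
      moreover have "Re (pencil_form r T u y y) = N" by (simp add: norm2 N_def)
      ultimately show ?thesis
        using nonneg[of "\<lambda>k i. if k = 0 then x i else of_real t * y i"] kernel
        unfolding sum2 m
        by (simp add: pencil_form_mult_left pencil_form_mult_right pencil_form_scaleR
            h_def[symmetric] power2_eq_square mult_ac)
    qed
    \<comment> \<open>A nonnegative quadratic without constant term has no linear term. The shift by
      1 covers \<open>N = 0\<close>.\<close>
    define t where "t = h / (N + 1)"
    have h: "h = t * (N + 1)" using N by (simp add: t_def)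
    have "0 \<le> 2 * (- t) * h + (- t)\<^sup>2 * N" by (rule quadratic)
    also have "\<dots> = - (t\<^sup>2 * (N + 2))"
      by (simp add: h algebra_simps power2_eq_square)
    finally have "t\<^sup>2 * (N + 2) \<le> 0" by simp
    then have "t = 0"
      using N by (simp add: mult_le_0_iff)
    then have "h = 0" by (simp add: h)
    then show ?thesis by (simp add: h_def)
  qed
  have zero: "pencil_form r T b x y = 0" if "inner p b = 0" for b y
  proof (rule complex_eqI)
    \<comment> \<open>Replacing \<open>y\<close> by \<open>\<i> * y\<close> turns the imaginary part
      into a real part.\<close>
    have "Re (pencil_form r T b x (\<lambda>i. \<i> * y i)) = 0" by (rule zero_Re[OF that])
    then show "Im (pencil_form r T b x y) = Im 0" by (simp add: pencil_form_mult_right)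
  qed (simp add: zero_Re[OF that])
  have "pencil_form r T b x y = of_real (inner p b) * (\<Sum>i<r. x i * cnj (y i))" for b y
  proof -
    have "inner p u = 1" using p by (simp add: dual_base_def)
    \<comment> \<open>Every \<open>b\<close> is a multiple of \<open>u\<close> plus a vector on
      which \<open>p\<close> vanishes.\<close>
    then have "pencil_form r T (b - inner p b *\<^sub>R u) x y = 0"
      by (intro zero) (simp add: inner_diff_right)
    then show ?thesis
      by (simp add: pencil_form_diff pencil_form_scaleR form_u)
  qed
  with x(1) that show ?thesis by blast
qed

lemma finite_joint_eigenvalues:
  fixes T :: "'n::finite \<Rightarrow> complex mat"
  assumes T: "\<And>i. T i \<in> Her r"
  shows "finite {p. \<exists>x. (\<Sum>i<r. (cmod (x i))\<^sup>2) = 1 \<and>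
    (\<forall>b y. pencil_form r T b x y = of_real (inner p b) * (\<Sum>i<r. x i * cnj (y i)))}"
    (is "finite ?P")
proof -
  have "\<forall>p\<in>?P. \<exists>x. (\<Sum>i<r. (cmod (x i))\<^sup>2) = 1 \<and>
    (\<forall>b y. pencil_form r T b x y = of_real (inner p b) * (\<Sum>i<r. x i * cnj (y i)))"
    by blast
  from bchoice[OF this] obtain X where "\<forall>p\<in>?P. (\<Sum>i<r. (cmod (X p i))\<^sup>2) = 1 \<and>
    (\<forall>b y. pencil_form r T b (X p) y = of_real (inner p b) * (\<Sum>i<r. X p i * cnj (y i)))"
    by blast
  then have X: "\<And>p. p \<in> ?P \<Longrightarrow> (\<Sum>i<r. (cmod (X p i))\<^sup>2) = 1"
    "\<And>p b y. p \<in> ?P \<Longrightarrow>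
      pencil_form r T b (X p) y = of_real (inner p b) * (\<Sum>i<r. X p i * cnj (y i))"
    by blast+
  have orth: "(\<Sum>i<r. X p i * cnj (X q i)) = of_bool (p = q)" if pq: "p \<in> ?P" "q \<in> ?P" for p q
  proof (cases "p = q")
    case True
    have "complex_of_real (\<Sum>i<r. (cmod (X q i))\<^sup>2) = 1" using X(1)[OF pq(2)] by simp
    then show ?thesis unfolding of_real_sum complex_norm_square using True by simp
  next
    case False
    define S where "S = (\<Sum>i<r. X p i * cnj (X q i))"
    have cnj_S: "cnj (\<Sum>i<r. X q i * cnj (X p i)) = S"
      unfolding S_def cnj_sum by (intro sum.cong refl) simp
    have "of_real (inner p b) * S = of_real (inner q b) * S" for b
    proof -
      have "of_real (inner p b) * S = pencil_form r T b (X p) (X q)"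
        using X(2)[OF pq(1)] by (simp add: S_def)
      also have "\<dots> = cnj (pencil_form r T b (X q) (X p))"
        by (simp add: cnj_pencil_form[OF T])
      also have "\<dots> = of_real (inner q b) * S"
        unfolding X(2)[OF pq(2)] complex_cnj_mult cnj_S by simp
      finally show ?thesis .
    qed
    \<comment> \<open>The direction \<open>p - q\<close> tells the two eigenvalues apart, so the
      inner product \<open>S\<close> must vanish.\<close>
    from this[of "p - q"] have "of_real (inner (p - q) (p - q)) * S = 0"
      by (simp add: inner_diff_left algebra_simps)
    then show ?thesis using False by (simp add: S_def)
  qed
  have "card G \<le> r" if "G \<subseteq> ?P" "finite G" for G
    using that orth by (intro finite_orthonormal_card_le[of G X r]) (auto simp: subset_iff)
  then show ?thesis
    using finite_if_finite_subsets_card_bdd by blast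
qed

lemma polyhedral_cone_if_realizable:
  fixes C :: "(real ^ 'n::finite) set" and u :: "real ^ 'n"
  assumes C: "closed C" "convex C" "cone C" and u: "u \<in> interior C"
    and "fin_dim_realizable (max_system C) u"
  shows "polyhedral_cone C"
proof -
  obtain r T where r: "1 \<le> r" and T: "\<And>i. T i \<in> Her r"
    and unit: "mat_sum r (\<lambda>i. complex_of_real (u $h i) \<cdot>\<^sub>m T i) = 1\<^sub>m r"
    and real: "\<And>s A. 1 \<le> s \<Longrightarrow> (\<And>i. A i \<in> Her s) \<Longrightarrow>
      A \<in> max_system C s \<longleftrightarrow> psd (r * s) (mat_sum (r * s) (\<lambda>i. T i \<otimes>\<^sub>K A i))"
    using assms(5) unfolding fin_dim_realizable_def by blast
  define E where "E = {p. \<exists>x. (\<Sum>i<r. (cmod (x i))\<^sup>2) = 1 \<and>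
    (\<forall>b y. pencil_form r T b x y = of_real (inner p b) * (\<Sum>i<r. x i * cnj (y i)))}"
  \<comment> \<open>Every point of the base is a valid constraint on \<open>C\<close>, so
    \<open>P\<close> may contain points that are not exposed; it suffices that the exposed points
    used for separation are among them.\<close>
  define P where "P = dual_base C u \<inter> E"
  have "finite P"
    using finite_joint_eigenvalues[of T r, OF T] by (simp add: P_def E_def)
  moreover have "C = (\<Inter>p\<in>P. {a. 0 \<le> inner p a})"
  proof (intro subset_antisym subsetI)
    fix a assume "a \<in> C"
    then show "a \<in> (\<Inter>p\<in>P. {a. 0 \<le> inner p a})"
      by (simp add: P_def dual_base_def)
  next
    fix a0 assume a0: "a0 \<in> (\<Inter>p\<in>P. {a. 0 \<le> inner p a})"
    show "a0 \<in> C"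
    proof (rule ccontr)
      assume "a0 \<notin> C"
      then obtain p a where p: "p \<in> dual_base C u" "inner p a0 < 0" "inner p a = 0"
        "\<And>l. l \<in> dual_base C u \<Longrightarrow> (norm (l - p))\<^sup>2 \<le> 2 * inner l a"
        using exposed_dual_base_point[OF C u] by metis
      then have "p \<in> E"
        using exposed_point_joint_eigenvalue[OF C u r T unit real p(1,3,4)]
        unfolding E_def by blast
      with p(1) have "p \<in> P" by (simp add: P_def)
      with a0 have "0 \<le> inner p a0" by blast
      with p(2) show False by simp
    qed
  qed
  moreover have "p \<noteq> 0" if "p \<in> P" for p
    using that by (auto simp: P_def dual_base_def)
  ultimately show ?thesis
    unfolding polyhedral_cone_def
    by (intro exI[of _ "(\<lambda>p. {a. 0 \<le> inner p a}) ` P"]) auto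
qed

section \<open>Diagonal realizations of polyhedral cones\<close>

text \<open>Diagonal coefficients make the Kronecker sum block diagonal, with one block of size
  \<open>s\<close> per functional \<open>l i\<close>.\<close>

lemma quad_form_kronecker_diagonal:
  fixes l :: "nat \<Rightarrow> real ^ 'n::finite"
  assumes A: "\<And>n. A n \<in> carrier_mat s s" and v: "v \<in> carrier_vec (r * s)"
  shows "Re (quad_form (mat_sum (r * s)
      (\<lambda>n. Matrix.mat r r (\<lambda>(i, j). if i = j then complex_of_real (l i $h n) else 0) \<otimes>\<^sub>K A n)) v) =
    (\<Sum>i<r. inner (l i) (\<chi> n. Re (quad_form (A n) (Matrix.vec s (\<lambda>j. v $ (i * s + j))))))"
proof -
  define T where "T n = Matrix.mat r r (\<lambda>(i, j). if i = j then complex_of_real (l i $h n) else 0)" for n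
  have T: "T n \<in> carrier_mat r r" for n by (simp add: T_def)
  have block: "(\<Sum>j<s. \<Sum>i'<r. \<Sum>k<s. (\<Sum>n\<in>UNIV. T n $$ (i, i') * A n $$ (j, k)) *
       v $ (i' * s + k) * cnj (v $ (i * s + j))) =
      (\<Sum>n\<in>UNIV. of_real (l i $h n) * quad_form (A n) (Matrix.vec s (\<lambda>j. v $ (i * s + j))))"
    if i: "i < r" for i
  proof -
    have "(\<Sum>i'<r. \<Sum>k<s. (\<Sum>n\<in>UNIV. T n $$ (i, i') * A n $$ (j, k)) *
         v $ (i' * s + k) * cnj (v $ (i * s + j))) =
        (\<Sum>i'<r. if i' = i then \<Sum>k<s. (\<Sum>n\<in>UNIV. of_real (l i $h n) * A n $$ (j, k)) *
         v $ (i * s + k) * cnj (v $ (i * s + j)) else 0)" for j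
      using i by (intro sum.cong refl) (simp add: T_def)
    then have "(\<Sum>j<s. \<Sum>i'<r. \<Sum>k<s. (\<Sum>n\<in>UNIV. T n $$ (i, i') * A n $$ (j, k)) *
         v $ (i' * s + k) * cnj (v $ (i * s + j))) =
        (\<Sum>j<s. \<Sum>k<s. \<Sum>n\<in>UNIV. of_real (l i $h n) *
          (A n $$ (j, k) * v $ (i * s + k) * cnj (v $ (i * s + j))))"
      using i by (simp add: sum_distrib_right mult.assoc)
    also have "\<dots> = (\<Sum>j<s. \<Sum>n\<in>UNIV. \<Sum>k<s. of_real (l i $h n) *
          (A n $$ (j, k) * v $ (i * s + k) * cnj (v $ (i * s + j))))"
      by (intro sum.cong refl sum.swap)
    also have "\<dots> = (\<Sum>n\<in>UNIV. \<Sum>j<s. \<Sum>k<s. of_real (l i $h n) *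
          (A n $$ (j, k) * v $ (i * s + k) * cnj (v $ (i * s + j))))"
      by (rule sum.swap)
    finally show ?thesis
      by (simp add: quad_form_eq_sum[OF A] sum_distrib_left)
  qed
  have "quad_form (mat_sum (r * s) (\<lambda>n. T n \<otimes>\<^sub>K A n)) v =
      (\<Sum>i<r. \<Sum>n\<in>UNIV. of_real (l i $h n) * quad_form (A n) (Matrix.vec s (\<lambda>j. v $ (i * s + j))))"
    unfolding quad_form_mat_sum_kronecker[OF T A v] by (intro sum.cong refl block) simp
  then show ?thesis
    by (simp add: T_def inner_vec_def Re_sum)
qed

lemma realizable_if_polyhedral_cone:
  fixes C :: "(real ^ 'n::finite) set" and u :: "real ^ 'n"
  assumes "salient C" and u: "u \<in> interior C" and "polyhedral_cone C"
  shows "fin_dim_realizable (max_system C) u"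
proof -
  obtain F where F: "finite F" "C = \<Inter>F" "\<forall>H\<in>F. \<exists>a. a \<noteq> 0 \<and> H = {x. inner a x \<ge> 0}"
    using assms(3) unfolding polyhedral_cone_def by blast
  from bchoice[OF F(3)] obtain g where g: "\<And>H. H \<in> F \<Longrightarrow> g H \<noteq> 0 \<and> H = {x. inner (g H) x \<ge> 0}"
    by blast
  obtain e where e: "0 < e" "\<And>l. (\<And>a. a \<in> C \<Longrightarrow> 0 \<le> inner l a) \<Longrightarrow> e * norm l \<le> inner l u"
    using dual_cone_norm_bound[OF u] by blast
  \<comment> \<open>Each defining functional is nonzero and nonnegative on \<open>C\<close>, so the
    norm bound makes it positive at the interior point \<open>u\<close>.\<close>
  have pos: "0 < inner (g H) u" if "H \<in> F" for H
  proof -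
    have "e * norm (g H) \<le> inner (g H) u"
      using that F(2) g[OF that] by (intro e(2)) blast
    moreover have "0 < e * norm (g H)" using e(1) g[OF that] by simp
    ultimately show ?thesis by linarith
  qed
  \<comment> \<open>The value 1 at \<open>u\<close> is what makes the diagonal matrix
    \<open>T(u)\<close> the identity.\<close>
  define L where "L = (\<lambda>H. (1 / inner (g H) u) *\<^sub>R g H) ` F"
  have "finite L" using F(1) by (simp add: L_def)
  have unit: "inner l u = 1" if l: "l \<in> L" for l
  proof -
    obtain H where "H \<in> F" "l = (1 / inner (g H) u) *\<^sub>R g H"
      using l unfolding L_def by blast
    with pos[of H] show ?thesis by simp
  qed
  have C_iff: "x \<in> C \<longleftrightarrow> (\<forall>l\<in>L. 0 \<le> inner l x)" for x
  proof -
    have "x \<in> H \<longleftrightarrow> 0 \<le> inner ((1 / inner (g H) u) *\<^sub>R g H) x" if "H \<in> F" for H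
    proof -
      have "x \<in> H \<longleftrightarrow> 0 \<le> inner (g H) x" using g[OF that] by blast
      then show ?thesis using pos[OF that] by (simp add: zero_le_divide_iff)
    qed
    then show ?thesis unfolding F(2) L_def by blast
  qed
  \<comment> \<open>Secures \<open>1 \<le> r\<close>: without constraints \<open>C\<close> would be
    the whole nonzero space, which is not salient.\<close>
  have "L \<noteq> {}"
  proof
    assume "L = {}"
    then have "C = UNIV" using C_iff by blast
    then have "(UNIV :: (real ^ 'n) set) = {0}"
      using assms(1) by (simp add: salient_def)
    moreover have "axis undefined 1 \<noteq> (0 :: real ^ 'n)" by simp
    ultimately show False by blast
  qed
  define r where "r = card L"
  have r: "1 \<le> r" using \<open>finite L\<close> \<open>L \<noteq> {}\<close> by (simp add: r_def Suc_le_eq card_gt_0_iff)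
  obtain l where "bij_betw l {0..<r} L"
    using ex_bij_betw_nat_finite[OF \<open>finite L\<close>] unfolding r_def by blast
  then have L: "L = l ` {..<r}" by (simp add: bij_betw_def atLeast0LessThan)
  define T where "T n = Matrix.mat r r (\<lambda>(i, j). if i = j then complex_of_real (l i $h n) else 0)" for n
  have T: "T n \<in> Her r" for n unfolding Her_iff_index by (simp add: T_def)
  have T_unit: "mat_sum r (\<lambda>n. complex_of_real (u $h n) \<cdot>\<^sub>m T n) = 1\<^sub>m r"
  proof (rule eq_matI)
    fix i j assume "i < dim_row (1\<^sub>m r :: complex mat)" "j < dim_col (1\<^sub>m r :: complex mat)"
    then have ij: "i < r" "j < r" by simp_all
    then have "mat_sum r (\<lambda>n. complex_of_real (u $h n) \<cdot>\<^sub>m T n) $$ (i, j) =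
        (if i = j then of_real (inner (l i) u) else 0)"
      by (simp add: mat_sum_def T_def inner_vec_def mult.commute)
    also have "\<dots> = 1\<^sub>m r $$ (i, j)"
      using ij unit[of "l i"] by (auto simp: L)
    finally show "mat_sum r (\<lambda>n. complex_of_real (u $h n) \<cdot>\<^sub>m T n) $$ (i, j) = 1\<^sub>m r $$ (i, j)" .
  qed (simp_all add: mat_sum_def)
  have real: "A \<in> max_system C s \<longleftrightarrow> psd (r * s) (mat_sum (r * s) (\<lambda>n. T n \<otimes>\<^sub>K A n))"
    if A: "\<And>n. A n \<in> Her s" for s A
  proof -
    have Ac: "A n \<in> carrier_mat s s" for n using A[of n] by (simp add: Her_def)
    let ?M = "mat_sum (r * s) (\<lambda>n. T n \<otimes>\<^sub>K A n)"
    let ?q = "\<lambda>v. \<chi> n. Re (quad_form (A n) v)"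
    have form: "Re (quad_form ?M v) =
        (\<Sum>i<r. inner (l i) (?q (Matrix.vec s (\<lambda>j. v $ (i * s + j)))))"
      if "v \<in> carrier_vec (r * s)" for v
      unfolding T_def by (rule quad_form_kronecker_diagonal[OF Ac that])
    show ?thesis
    proof
      assume max: "A \<in> max_system C s"
      have "0 \<le> Re (quad_form ?M v)" if "v \<in> carrier_vec (r * s)" for v
        unfolding form[OF that]
      proof (intro sum_nonneg)
        fix i assume "i \<in> {..<r}"
        moreover have "?q (Matrix.vec s (\<lambda>j. v $ (i * s + j))) \<in> C"
          using max by (simp add: max_system_def)
        ultimately show "0 \<le> inner (l i) (?q (Matrix.vec s (\<lambda>j. v $ (i * s + j))))"
          unfolding C_iff L by blast
      qed
      then show "psd (r * s) ?M"
        using mat_sum_kronecker_Her[OF T A] by (simp add: psd_def)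
    next
      assume psd: "psd (r * s) ?M"
      have "?q v \<in> C" if v: "v \<in> carrier_vec s" for v
        unfolding C_iff L
      proof clarify
        fix i assume i: "i < r"
        \<comment> \<open>Places \<open>v\<close> in block \<open>i\<close> and zeros elsewhere,
          which isolates the constraint \<open>l i\<close>.\<close>
        define w where "w = Matrix.vec (r * s) (\<lambda>k. if k div s = i then v $ (k mod s) else 0)"
        have w: "w \<in> carrier_vec (r * s)" by (simp add: w_def)
        have blocks: "Matrix.vec s (\<lambda>j. w $ (i' * s + j)) = (if i' = i then v else 0\<^sub>v s)"
          if "i' < r" for i'
          using that v by (intro eq_vecI) (auto simp: w_def mult_add_less_mult)
        have "?q (0\<^sub>v s) = 0"
          by (simp add: Finite_Cartesian_Product.vec_eq_iff quad_form_eq_sum[OF Ac])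
        then have "Re (quad_form ?M w) = (\<Sum>i'<r. if i' = i then inner (l i) (?q v) else 0)"
          unfolding form[OF w] by (intro sum.cong refl) (simp add: blocks)
        also have "\<dots> = inner (l i) (?q v)"
          using i by simp
        finally show "0 \<le> inner (l i) (?q v)"
          using psd w unfolding psd_def by metis
      qed
      then show "A \<in> max_system C s"
        using A by (simp add: max_system_def)
    qed
  qed
  have "\<forall>s\<ge>1. \<forall>A. (\<forall>n. A n \<in> Her s) \<longrightarrow>
      (A \<in> max_system C s \<longleftrightarrow> psd (r * s) (mat_sum (r * s) (\<lambda>n. T n \<otimes>\<^sub>K A n)))"
    by (intro allI impI) (rule real, erule spec)
  moreover have "\<forall>n. T n \<in> Her r" using T by (rule allI)
  ultimately show ?thesis
    unfolding fin_dim_realizable_def using r T_unit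
    by (intro exI[of _ r] conjI exI[of _ T])
qed

theorem theorem3p2:
  fixes C :: "(real ^ 'n) set" and u :: "real ^ 'n"
  assumes "closed C" and "convex C" and "cone C" and "salient C"
    and "u \<in> interior C"
  shows "fin_dim_realizable (max_system C) u \<longleftrightarrow> polyhedral_cone C"
  using polyhedral_cone_if_realizable realizable_if_polyhedral_cone assms by blast

end
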